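(* Let $d$ be either the discrete metric ($d_{12}=d_{13}=d_{23}=1$) or the $L_1$-metric ($d_{12}=d_{23}=1$, $d_{13}=2$) on the state space $[3]=\{1,2,3\}$. Let $\mathcal{M}\subset\Delta_2$ be the Hardy-Weinberg curve, i.e. the image of $[0,1]\to\Delta_2$, $p\mapsto (p^2,\,2p(1-p),\,(1-p)^2)$. Then for every $\mu=(\mu_1,\mu_2,\mu_3)\in\Delta_2$ the Wasserstein distance from $\mu$ to $\mathcal{M}$ equals $$W_d(\mu,\mathcal{M})=\begin{cases} |2\sqrt{\mu_1}-2\mu_1-\mu_2| & \text{if } \mu_1-\mu_3\ge 0 \text{ and } \mu_1\ge \tfrac14,\\ |2\sqrt{\mu_3}-2\mu_3-\mu_2| & \text{if } \mu_1-\mu_3\le 0 \text{ and } \mu_3\ge \tfrac14,\\ \mu_2-\tfrac12 & \text{if } \mu_1\le \tfrac14 \text{ and } \mu_3\le\tfrac14. \end{cases}$$ The solution function $\mu\mapsto\nu^*(\mu)=\operatorname{argmin}_{\nu\in\mathcal{M}}W_d(\mu,\nu)$ is given, with the same case distinction (in the same order), by $$\nu^*(\mu)=\begin{cases} (\mu_1,\;2\sqrt{\mu_1}-2\mu_1,\;1+\mu_1-2\sqrt{\mu_1}),\\ (1+\mu_3-2\sqrt{\mu_3},\;2\sqrt{\mu_3}-2\mu_3,\;\mu_3),\\ (\tfrac14,\tfrac12,\tfrac14). \end{cases}$$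
   Context: $\Delta_{n-1}=\{(\nu_1,\dots,\nu_n)\in\mathbb{R}^n_{\ge0}:\sum_i\nu_i=1\}$. For a metric $d=(d_{ij})$ on $[n]=\{1,\dots,n\}$ and $\mu,\nu\in\Delta_{n-1}$, the Wasserstein distance is $$W_d(\mu,\nu)=\max\Bigl\{\sum_{i=1}^n(\mu_i-\nu_i)x_i \;:\; x\in\mathbb{R}^n,\ |x_i-x_j|\le d_{ij}\text{ for all }1\le i<j\le n\Bigr\},$$ and for a compact set $\mathcal{M}\subset\Delta_{n-1}$ one puts $W_d(\mu,\mathcal{M})=\min_{\nu\in\mathcal{M}}W_d(\mu,\nu)$. The solution function (argmin) may be multivalued: at points $\mu$ satisfying the conditions of several cases, its values are the points given by all applicable cases. *)

theory Defs
  imports "HOL-Analysis.Analysis"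
begin

text \<open>Distributions on a finite state space are vectors indexed by a finite type \<open>'n\<close>.
  The state space \<open>{1, 2, 3}\<close> is the numeral type \<open>3\<close>, whose elements are \<open>1\<close>, \<open>2\<close>
  and \<open>3\<close> (the last one coincides with \<open>0\<close>).\<close>

definition prob_simplex :: "(real ^ 'n) set" where
  "prob_simplex = {\<nu>. (\<forall>i. 0 \<le> \<nu> $ i) \<and> (\<Sum>i\<in>UNIV. \<nu> $ i) = 1}"

text \<open>\<open>GREATEST\<close> and \<open>LEAST\<close> denote an attained maximum and minimum, not merely a supremum
  and infimum. Quantifying over all pairs \<open>i\<close>, \<open>j\<close> rather than over \<open>i < j\<close> makes no
  difference for a metric \<open>d\<close>, which is symmetric and vanishes on the diagonal.\<close>

definition wasserstein :: "('n \<Rightarrow> 'n \<Rightarrow> real) \<Rightarrow> real ^ 'n \<Rightarrow> real ^ 'n \<Rightarrow> real" where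
  "wasserstein d \<mu> \<nu> =
     (GREATEST w. \<exists>x :: real ^ 'n. (\<forall>i j. \<bar>x $ i - x $ j\<bar> \<le> d i j) \<and>
                                 w = (\<Sum>i\<in>UNIV. (\<mu> $ i - \<nu> $ i) * x $ i))"

definition wasserstein_set :: "('n \<Rightarrow> 'n \<Rightarrow> real) \<Rightarrow> real ^ 'n \<Rightarrow> (real ^ 'n) set \<Rightarrow> real" where
  "wasserstein_set d \<mu> M = (LEAST w. \<exists>\<nu>\<in>M. w = wasserstein d \<mu> \<nu>)"

definition wasserstein_argmin ::
    "('n \<Rightarrow> 'n \<Rightarrow> real) \<Rightarrow> real ^ 'n \<Rightarrow> (real ^ 'n) set \<Rightarrow> (real ^ 'n) set" where
  "wasserstein_argmin d \<mu> M = {\<nu>. is_arg_min (wasserstein d \<mu>) (\<lambda>\<nu>. \<nu> \<in> M) \<nu>}"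

definition hardy_weinberg :: "(real ^ 3) set" where
  "hardy_weinberg = (\<lambda>p. vector [p\<^sup>2, 2 * p * (1 - p), (1 - p)\<^sup>2]) ` {0..1}"

end

theory Submission
  imports Defs
begin

text \<open>Put \<open>u = \<mu> - \<nu>\<close>, a vector with sum zero. The Wasserstein distance is
  \<open>max \<bar>u\<^sub>i\<bar>\<close> for the discrete metric and \<open>\<bar>u\<^sub>1\<bar> + \<bar>u\<^sub>3\<bar>\<close> for the \<open>L\<^sub>1\<close>-metric, so in both cases
  it is at least every \<open>\<bar>u\<^sub>i\<bar>\<close>, and it equals \<open>\<bar>u\<^sub>2\<bar>\<close> as soon as \<open>u\<^sub>1\<close> and \<open>u\<^sub>3\<close> do not have strictly
  opposite signs. The latter holds at the claimed minimizers, whereas at any other point of the curve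
  one of the three \<open>\<bar>u\<^sub>i\<bar>\<close> already exceeds the claimed minimum. The parameter change \<open>p \<mapsto> 1 - p\<close>
  exchanges the first two cases.\<close>

section \<open>Wasserstein distances for the two metrics on three states\<close>

lemma wasserstein_eqI:
  fixes \<mu> \<nu> :: "real ^ 'n"
  assumes "\<forall>i j. \<bar>x $ i - x $ j\<bar> \<le> d i j"
    and "(\<Sum>i\<in>UNIV. (\<mu> $ i - \<nu> $ i) * x $ i) = w"
    and "\<And>y :: real ^ 'n. \<forall>i j. \<bar>y $ i - y $ j\<bar> \<le> d i j \<Longrightarrow> (\<Sum>i\<in>UNIV. (\<mu> $ i - \<nu> $ i) * y $ i) \<le> w"
  shows "wasserstein d \<mu> \<nu> = w"
  unfolding wasserstein_def using assms by (intro Greatest_equality) blast+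

text \<open>Symmetry and the zero diagonal reduce the nine constraints to three, which involve
  exactly the values of \<open>d\<close> that specify the two metrics.\<close>

lemma Metric_space_UNIV_3_Lipschitz_iff:
  fixes x :: "real ^ 3"
  assumes "Metric_space UNIV d"
  shows "(\<forall>i j. \<bar>x $ i - x $ j\<bar> \<le> d i j) \<longleftrightarrow>
    \<bar>x $ 1 - x $ 2\<bar> \<le> d 1 2 \<and> \<bar>x $ 1 - x $ 3\<bar> \<le> d 1 3 \<and> \<bar>x $ 2 - x $ 3\<bar> \<le> d 2 3"
proof -
  interpret Metric_space UNIV d by fact
  have "d i i = 0" for i by simp
  then show ?thesis
    unfolding forall_3 using commute[of 2 1] commute[of 3 1] commute[of 3 2]
    by (auto simp: abs_minus_commute)
qed

lemma prob_simplex_3: "\<mu> \<in> prob_simplex \<longleftrightarrow>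
    0 \<le> \<mu> $ 1 \<and> 0 \<le> \<mu> $ 2 \<and> 0 \<le> \<mu> $ 3 \<and> \<mu> $ 1 + \<mu> $ 2 + \<mu> $ (3::3) = 1"
  by (auto simp: prob_simplex_def forall_3 sum_3)

lemma wasserstein_discrete_3:
  fixes d :: "3 \<Rightarrow> 3 \<Rightarrow> real"
  assumes d: "Metric_space UNIV d" "d 1 2 = 1" "d 1 3 = 1" "d 2 3 = 1"
    and u: "(\<mu> $ 1 - \<nu> $ 1) + (\<mu> $ 2 - \<nu> $ 2) + (\<mu> $ 3 - \<nu> $ 3) = 0"
  shows "wasserstein d \<mu> \<nu> = Max {\<bar>\<mu> $ 1 - \<nu> $ 1\<bar>, \<bar>\<mu> $ 2 - \<nu> $ 2\<bar>, \<bar>\<mu> $ 3 - \<nu> $ 3\<bar>}"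
proof -
  define u1 u2 u3 where u_def: "u1 = \<mu> $ 1 - \<nu> $ 1" "u2 = \<mu> $ 2 - \<nu> $ 2" "u3 = \<mu> $ 3 - \<nu> $ 3"
  define m where "m = Max {\<bar>u1\<bar>, \<bar>u2\<bar>, \<bar>u3\<bar>}"
  have m: "\<bar>u1\<bar> \<le> m" "\<bar>u2\<bar> \<le> m" "\<bar>u3\<bar> \<le> m" "m = \<bar>u1\<bar> \<or> m = \<bar>u2\<bar> \<or> m = \<bar>u3\<bar>"
    by (auto simp: m_def max_def)
  \<comment> \<open>An optimal potential: the sign of \<open>u\<close> at one index where its
    absolute value is largest, and zero elsewhere.\<close>
  define x :: "real ^ 3" where
    "x = (if m = \<bar>u1\<bar> then vector [sgn u1, 0, 0] else if m = \<bar>u2\<bar> then vector [0, sgn u2, 0]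
          else vector [0, 0, sgn u3])"
  have "u1 * y1 + u2 * y2 + u3 * y3 \<le> m"
    if "\<bar>y1 - y2\<bar> \<le> 1" "\<bar>y1 - y3\<bar> \<le> 1" "\<bar>y2 - y3\<bar> \<le> 1" for y1 y2 y3
  proof -
    \<comment> \<open>As \<open>u\<close> has sum zero, shifting \<open>y\<close> by a constant does
      not change the objective; after subtracting the minimum all entries lie in [0, 1].\<close>
    define lo where "lo = Min {y1, y2, y3}"
    have lo: "lo \<le> y1 \<and> y1 \<le> lo + 1" "lo \<le> y2 \<and> y2 \<le> lo + 1" "lo \<le> y3 \<and> y3 \<le> lo + 1"
      using that by (auto simp: lo_def min_def)
    have *: "v * z \<le> max v 0" if "0 \<le> z \<and> z \<le> 1" for v z :: real
      using that by (cases "v \<ge> 0") (auto simp: mult_left_le mult_nonpos_nonneg)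
    have "u1 * y1 + u2 * y2 + u3 * y3 = u1 * (y1 - lo) + u2 * (y2 - lo) + u3 * (y3 - lo)"
      using u unfolding u_def[symmetric] by algebra
    also have "\<dots> \<le> max u1 0 + max u2 0 + max u3 0"
      using lo by (intro add_mono *) auto
    \<comment> \<open>The positive and the negative parts of \<open>u\<close> have the same total.
      Among three entries, one of the two signs occurs at most once, so this total is at most the
      largest absolute value.\<close>
    also have "\<dots> \<le> m"
      using m u unfolding u_def[symmetric] by (auto simp: max_def abs_if split: if_splits)
    finally show ?thesis .
  qed
  moreover have "\<forall>i j. \<bar>x $ i - x $ j\<bar> \<le> d i j"
    unfolding Metric_space_UNIV_3_Lipschitz_iff[OF d(1)] d by (simp add: x_def sgn_if)
  moreover have "u1 * x $ 1 + u2 * x $ 2 + u3 * x $ 3 = m"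
    using m(4) by (auto simp: x_def simp flip: abs_sgn)
  ultimately have "wasserstein d \<mu> \<nu> = m"
    using Metric_space_UNIV_3_Lipschitz_iff[OF d(1)] d(2-)
    by (intro wasserstein_eqI[of x]) (auto simp: sum_3 u_def)
  then show ?thesis by (simp add: m_def u_def)
qed

text \<open>Eliminating \<open>u2\<close> leaves an objective in \<open>y1 - y2\<close> and
  \<open>y3 - y2\<close>, which may be chosen independently in [-1, 1] because
  \<open>d 1 3 = 2\<close>. The signs of \<open>u1\<close> and \<open>u3\<close> are the best
  choice.\<close>

lemma wasserstein_L1_3:
  fixes d :: "3 \<Rightarrow> 3 \<Rightarrow> real"
  assumes d: "Metric_space UNIV d" "d 1 2 = 1" "d 2 3 = 1" "d 1 3 = 2"
    and u: "(\<mu> $ 1 - \<nu> $ 1) + (\<mu> $ 2 - \<nu> $ 2) + (\<mu> $ 3 - \<nu> $ 3) = 0"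
  shows "wasserstein d \<mu> \<nu> = \<bar>\<mu> $ 1 - \<nu> $ 1\<bar> + \<bar>\<mu> $ 3 - \<nu> $ 3\<bar>"
proof -
  define u1 u2 u3 where u_def: "u1 = \<mu> $ 1 - \<nu> $ 1" "u2 = \<mu> $ 2 - \<nu> $ 2" "u3 = \<mu> $ 3 - \<nu> $ 3"
  define x :: "real ^ 3" where "x = vector [sgn u1, 0, sgn u3]"
  have "u1 * y1 + u2 * y2 + u3 * y3 \<le> \<bar>u1\<bar> + \<bar>u3\<bar>"
    if "\<bar>y1 - y2\<bar> \<le> 1" "\<bar>y2 - y3\<bar> \<le> 1" for y1 y2 y3
  proof -
    have *: "v * z \<le> \<bar>v\<bar>" if "\<bar>z\<bar> \<le> 1" for v z :: real
      using that mult_left_le[of "\<bar>z\<bar>" "\<bar>v\<bar>"] abs_ge_self[of "v * z"] by (simp add: abs_mult)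
    have "u1 * y1 + u2 * y2 + u3 * y3 = u1 * (y1 - y2) + u3 * (y3 - y2)"
      using u unfolding u_def[symmetric] by algebra
    also have "\<dots> \<le> \<bar>u1\<bar> + \<bar>u3\<bar>"
      using that by (intro add_mono *) auto
    finally show ?thesis .
  qed
  moreover have "\<forall>i j. \<bar>x $ i - x $ j\<bar> \<le> d i j"
    unfolding Metric_space_UNIV_3_Lipschitz_iff[OF d(1)] d by (simp add: x_def sgn_if)
  moreover have "u1 * x $ 1 + u2 * x $ 2 + u3 * x $ 3 = \<bar>u1\<bar> + \<bar>u3\<bar>"
    by (simp add: x_def flip: abs_sgn)
  ultimately have "wasserstein d \<mu> \<nu> = \<bar>u1\<bar> + \<bar>u3\<bar>"
    using Metric_space_UNIV_3_Lipschitz_iff[OF d(1)] d(2-)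
    by (intro wasserstein_eqI[of x]) (auto simp: sum_3 u_def)
  then show ?thesis by (simp add: u_def)
qed

section \<open>Nearest points on the Hardy-Weinberg curve\<close>

lemma wasserstein_minimum:
  assumes "\<And>\<nu>. \<nu> \<in> M \<Longrightarrow> m \<le> wasserstein d \<mu> \<nu>" "\<nu>\<^sub>0 \<in> M" "wasserstein d \<mu> \<nu>\<^sub>0 = m"
  shows "wasserstein_set d \<mu> M = m"
    and "wasserstein_argmin d \<mu> M = {\<nu> \<in> M. wasserstein d \<mu> \<nu> = m}"
proof -
  show "wasserstein_set d \<mu> M = m"
    unfolding wasserstein_set_def using assms by (intro Least_equality) auto
  show "wasserstein_argmin d \<mu> M = {\<nu> \<in> M. wasserstein d \<mu> \<nu> = m}"
    unfolding wasserstein_argmin_def is_arg_min_def using assms by (force simp: not_less)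
qed

abbreviation hw_point :: "real \<Rightarrow> real ^ 3" where
  "hw_point p \<equiv> vector [p\<^sup>2, 2 * p * (1 - p), (1 - p)\<^sup>2]"

text \<open>Here \<open>s\<close> is the square root of the first entry of \<mu>, \<open>c\<close>
  is the third entry, and \<open>w\<close> stands for the distance to the curve point with parameter
  \<open>p\<close>. Only the bounds common to both metrics are assumed of \<open>w\<close>. At
  \<open>p = s\<close> the first difference vanishes and the third is
  \<open>c - (1 - s)\<^sup>2\<close>. The second way to reach equality is the mirror image of
  \<open>s\<close>, for symmetric \<mu>.\<close>

lemma hardy_weinberg_lower_bound:
  fixes s c p w :: real
  assumes s: "1/2 \<le> s" "s \<le> 1" "c \<le> s\<^sup>2" and p: "0 \<le> p"  "p \<le> 1"
    and w: "\<bar>s\<^sup>2 - p\<^sup>2\<bar> \<le> w" "\<bar>(1 - s\<^sup>2 - c) - 2 * p * (1 - p)\<bar> \<le> w" "\<bar>c - (1 - p)\<^sup>2\<bar> \<le> w"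
  shows "\<bar>c - (1 - s)\<^sup>2\<bar> \<le> w"
    and "\<bar>c - (1 - s)\<^sup>2\<bar> = w \<Longrightarrow> p = s \<or> c = s\<^sup>2 \<and> p = 1 - s"
proof -
  \<comment> \<open>The middle difference is a quadratic in \<open>p\<close> symmetric about 1/2, so
    it takes its value at \<open>s\<close> again at \<open>1 - s\<close>; it is smaller strictly
    between these points and larger outside.\<close>
  have u2: "1 - s\<^sup>2 - c - 2 * p * (1 - p) = (1 - s)\<^sup>2 - c + 2 * (p - s) * (p - (1 - s))"
    by (simp add: power2_eq_square algebra_simps)
  have "\<bar>c - (1 - s)\<^sup>2\<bar> < w \<or> \<bar>c - (1 - s)\<^sup>2\<bar> \<le> w \<and> (p = s \<or> c = s\<^sup>2 \<and> p = 1 - s)"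
  proof (cases "p = s")
    case True
    then show ?thesis using w by auto
  next
    case False
    \<comment> \<open>The side of \<open>s\<close> on which \<open>p\<close> lies and the sign of
      \<open>c - (1 - s)\<^sup>2\<close> decide which difference is large enough: the third for
      \<open>up\<close> and \<open>down'\<close>, the middle one for \<open>up'\<close> and
      \<open>between\<close>, the first for \<open>down\<close>.\<close>
    consider (up) "p > s" "c \<ge> (1 - s)\<^sup>2" | (up') "p > s" "c < (1 - s)\<^sup>2"
      | (down') "p < s" "c < (1 - s)\<^sup>2"
      | (between) "p < s" "1 - s < p" "c \<ge> (1 - s)\<^sup>2"
      | (down) "p \<le> 1 - s" "c \<ge> (1 - s)\<^sup>2"
      using False by linarith
    then show ?thesis
    proof cases
      case up
      have "(1 - p)\<^sup>2 < (1 - s)\<^sup>2"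
        using up p by (intro power_strict_mono) auto
      then show ?thesis using w up by linarith
    next
      case up'
      have "(p - s) * (p - (1 - s)) > 0"
        using up' s by (intro mult_pos_pos) auto
      then show ?thesis using w(2) up' unfolding u2 by linarith
    next
      case down'
      have "(1 - s)\<^sup>2 < (1 - p)\<^sup>2"
        using down' s by (intro power_strict_mono) auto
      then show ?thesis using w down' by linarith
    next
      case between
      have "(p - s) * (p - (1 - s)) < 0"
        using between by (intro mult_neg_pos) auto
      then show ?thesis using w(2) between unfolding u2 by linarith
    next
      case down
      \<comment> \<open>Combined with \<open>c \<le> s\<^sup>2\<close> this bounds the first
        difference below by \<open>c - (1 - s)\<^sup>2\<close>. Equality requires both inequalities
        to be tight, which is the exceptional case \<open>c = s\<^sup>2\<close>,
        \<open>p = 1 - s\<close>.\<close>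
      have "p\<^sup>2 \<le> (1 - s)\<^sup>2"
        using down p by (intro power_mono) auto
      moreover have "p\<^sup>2 < (1 - s)\<^sup>2" if "p \<noteq> 1 - s"
        using down p that by (intro power_strict_mono) auto
      ultimately show ?thesis using w(1) down s(3) by fastforce
    qed
  qed
  then show "\<bar>c - (1 - s)\<^sup>2\<bar> \<le> w"
    and "\<bar>c - (1 - s)\<^sup>2\<bar> = w \<Longrightarrow> p = s \<or> c = s\<^sup>2 \<and> p = 1 - s"
    by auto
qed

theorem theorem1:
  fixes d :: "3 \<Rightarrow> 3 \<Rightarrow> real" and \<mu> :: "real ^ 3"
  assumes metric: "Metric_space UNIV d"
    and discrete_or_L1:
      "(d 1 2 = 1 \<and> d 1 3 = 1 \<and> d 2 3 = 1) \<or> (d 1 2 = 1 \<and> d 2 3 = 1 \<and> d 1 3 = 2)"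
    and mu: "\<mu> \<in> prob_simplex"
  shows
    "(\<mu>$1 - \<mu>$3 \<ge> 0 \<and> \<mu>$1 \<ge> 1/4 \<longrightarrow>
        wasserstein_set d \<mu> hardy_weinberg = \<bar>2 * sqrt (\<mu>$1) - 2 * \<mu>$1 - \<mu>$2\<bar>) \<and>
     (\<mu>$1 - \<mu>$3 \<le> 0 \<and> \<mu>$3 \<ge> 1/4 \<longrightarrow>
        wasserstein_set d \<mu> hardy_weinberg = \<bar>2 * sqrt (\<mu>$3) - 2 * \<mu>$3 - \<mu>$2\<bar>) \<and>
     (\<mu>$1 \<le> 1/4 \<and> \<mu>$3 \<le> 1/4 \<longrightarrow>
        wasserstein_set d \<mu> hardy_weinberg = \<mu>$2 - 1/2) \<and>
     wasserstein_argmin d \<mu> hardy_weinberg =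
       {\<nu>. (\<mu>$1 - \<mu>$3 \<ge> 0 \<and> \<mu>$1 \<ge> 1/4 \<and>
              \<nu> = vector [\<mu>$1, 2 * sqrt (\<mu>$1) - 2 * \<mu>$1, 1 + \<mu>$1 - 2 * sqrt (\<mu>$1)]) \<or>
           (\<mu>$1 - \<mu>$3 \<le> 0 \<and> \<mu>$3 \<ge> 1/4 \<and>
              \<nu> = vector [1 + \<mu>$3 - 2 * sqrt (\<mu>$3), 2 * sqrt (\<mu>$3) - 2 * \<mu>$3, \<mu>$3]) \<or>
           (\<mu>$1 \<le> 1/4 \<and> \<mu>$3 \<le> 1/4 \<and> \<nu> = vector [1/4, 1/2, 1/4])}"
proof -
  define a c where ac_def: "a = \<mu> $ 1" "c = \<mu> $ 3"
  define s t where st_def: "s = sqrt a" "t = sqrt c"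
  have b: "\<mu> $ 2 = 1 - a - c" and ac: "0 \<le> a" "0 \<le> c" "a \<le> 1" "c \<le> 1"
    using mu by (auto simp: prob_simplex_3 ac_def)
  have st: "s\<^sup>2 = a" "t\<^sup>2 = c" "s \<le> 1" "t \<le> 1"
    using ac by (auto simp: st_def)
  define W where "W p = wasserstein d \<mu> (hw_point p)" for p
  have u: "(\<mu> $ 1 - hw_point p $ 1) + (\<mu> $ 2 - hw_point p $ 2) + (\<mu> $ 3 - hw_point p $ 3) = 0" for p
    unfolding b ac_def[symmetric] by (simp add: power2_eq_square algebra_simps)
  \<comment> \<open>From this disjunction on the two metrics are treated alike, through
    \<open>W_ge\<close> and \<open>W_eq\<close>.\<close>
  have W_cases: "W p = Max {\<bar>a - p\<^sup>2\<bar>, \<bar>1 - a - c - 2 * p * (1 - p)\<bar>, \<bar>c - (1 - p)\<^sup>2\<bar>} \<or>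
      W p = \<bar>a - p\<^sup>2\<bar> + \<bar>c - (1 - p)\<^sup>2\<bar>" for p
    using discrete_or_L1 wasserstein_discrete_3[OF metric _ _ _ u, of p]
      wasserstein_L1_3[OF metric _ _ _ u, of p]
    by (auto simp: W_def b ac_def[symmetric])
  have sum0: "1 - a - c - 2 * p * (1 - p) = - (a - p\<^sup>2) - (c - (1 - p)\<^sup>2)" for p
    by (simp add: power2_eq_square algebra_simps)
  have W_ge: "\<bar>a - p\<^sup>2\<bar> \<le> W p" "\<bar>1 - a - c - 2 * p * (1 - p)\<bar> \<le> W p" "\<bar>c - (1 - p)\<^sup>2\<bar> \<le> W p" for p
    using W_cases[of p] unfolding sum0 by (auto simp: le_max_iff_disj)
  \<comment> \<open>When the outer differences have no strictly opposite signs, the middle one has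
    absolute value the sum of theirs; this is both the maximum and the \<open>L\<^sub>1\<close>
    value.\<close>
  have W_eq: "W p = \<bar>1 - a - c - 2 * p * (1 - p)\<bar>"
    if "a \<le> p\<^sup>2 \<and> c \<le> (1 - p)\<^sup>2 \<or> a \<ge> p\<^sup>2 \<and> c \<ge> (1 - p)\<^sup>2" for p
    using W_cases[of p] that unfolding sum0 by auto
  \<comment> \<open>Moves the problem from the curve to its parameter; \<open>P\<close> has to be
    the full set of minimizing parameters in [0, 1].\<close>
  have minimum: "wasserstein_set d \<mu> hardy_weinberg = m \<and>
      wasserstein_argmin d \<mu> hardy_weinberg = hw_point ` P"
    if lower: "\<And>p. p \<in> {0..1} \<Longrightarrow> m \<le> W p"
      and unique: "\<And>p. p \<in> {0..1} \<Longrightarrow> m = W p \<Longrightarrow> p \<in> P"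
      and range: "P \<noteq> {}" "P \<subseteq> {0..1}" and attained: "\<And>p. p \<in> P \<Longrightarrow> W p = m" for m P
  proof -
    obtain p where p: "p \<in> P" using range(1) by blast
    have ge: "m \<le> wasserstein d \<mu> \<nu>" if "\<nu> \<in> hardy_weinberg" for \<nu>
      using that lower unfolding hardy_weinberg_def W_def by blast
    have mem: "hw_point p \<in> hardy_weinberg"
      using p range(2) unfolding hardy_weinberg_def by blast
    have eq: "wasserstein d \<mu> (hw_point p) = m"
      using attained[OF p] unfolding W_def .
    have "{\<nu> \<in> hardy_weinberg. wasserstein d \<mu> \<nu> = m} = hw_point ` {p \<in> {0..1}. W p = m}"
      unfolding hardy_weinberg_def W_def by blast
    moreover have "{p \<in> {0..1}. W p = m} = P"
      using unique range(2) attained by blast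
    ultimately show ?thesis
      using wasserstein_minimum[OF ge mem eq] by simp
  qed
  have s: "1/2 \<le> s" if "1/4 \<le> a"
    using that unfolding st_def by (intro real_le_rsqrt) (simp add: power2_eq_square)
  have t: "1/2 \<le> t" if "1/4 \<le> c"
    using that unfolding st_def by (intro real_le_rsqrt) (simp add: power2_eq_square)
  \<comment> \<open>The claimed value has two readings at \<open>p = s\<close>: the negated middle
    difference serves to compute \<open>W s\<close>, the third difference to apply the lower
    bound.\<close>
  have u2_s: "2 * s - 2 * a - \<mu> $ 2 = - (1 - a - c - 2 * s * (1 - s))"
    and u3_s: "2 * s - 2 * a - \<mu> $ 2 = c - (1 - s)\<^sup>2"
    unfolding b st(1)[symmetric] by (simp_all add: power2_eq_square algebra_simps)
  have u2_t: "2 * t - 2 * c - \<mu> $ 2 = - (1 - a - c - 2 * (1 - t) * (1 - (1 - t)))"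
    and u3_t: "2 * t - 2 * c - \<mu> $ 2 = a - (1 - t)\<^sup>2"
    unfolding b st(2)[symmetric] by (simp_all add: power2_eq_square algebra_simps)
  have W_s: "W s = \<bar>2 * s - 2 * a - \<mu> $ 2\<bar>"
    unfolding u2_s abs_minus_cancel by (rule W_eq) (use st in auto)
  have W_t: "W (1 - t) = \<bar>2 * t - 2 * c - \<mu> $ 2\<bar>"
    unfolding u2_t abs_minus_cancel by (rule W_eq) (use st in auto)
  have pt_s: "hw_point s = vector [a, 2 * s - 2 * a, 1 + a - 2 * s]"
    and pt_t: "hw_point (1 - t) = vector [1 + c - 2 * t, 2 * t - 2 * c, c]"
    using st by (auto simp: power2_eq_square algebra_simps)
  have pt_half: "hw_point (1/2) = vector [1/4, 1/2, 1/4]"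
    by (simp add: power2_eq_square)
  have case1: "wasserstein_set d \<mu> hardy_weinberg = \<bar>2 * s - 2 * a - \<mu> $ 2\<bar>"
      "wasserstein_argmin d \<mu> hardy_weinberg = hw_point ` {p. p = s \<or> c = a \<and> p = 1 - t}"
    if "a \<ge> c" "a \<ge> 1/4"
  proof -
    have st_eq: "s = t" if "c = a" using that by (simp add: st_def)
    note lb = hardy_weinberg_lower_bound[of s c, unfolded st, OF s[OF that(2)] st(3) that(1) _ _ W_ge,
        folded u3_s]
    have lower: "\<bar>2 * s - 2 * a - \<mu> $ 2\<bar> \<le> W p" if "p \<in> {0..1}" for p
      by (rule lb(1)) (use that in auto)
    have unique: "p \<in> {p. p = s \<or> c = a \<and> p = 1 - t}" if "p \<in> {0..1}" "\<bar>2 * s - 2 * a - \<mu> $ 2\<bar> = W p" for p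
      using lb(2)[OF _ _ that(2)] that(1) st_eq by auto
    have attained: "W p = \<bar>2 * s - 2 * a - \<mu> $ 2\<bar>" if "p \<in> {p. p = s \<or> c = a \<and> p = 1 - t}" for p
      using that W_s W_t st_eq by auto
    have range: "{p. p = s \<or> c = a \<and> p = 1 - t} \<subseteq> {0..1}" "{p. p = s \<or> c = a \<and> p = 1 - t} \<noteq> {}"
      using s[OF that(2)] st(3,4) st_eq by auto
    show "wasserstein_set d \<mu> hardy_weinberg = \<bar>2 * s - 2 * a - \<mu> $ 2\<bar>"
      "wasserstein_argmin d \<mu> hardy_weinberg = hw_point ` {p. p = s \<or> c = a \<and> p = 1 - t}"
      using minimum[OF lower unique range(2,1) attained] by blast+
  qed
  have case2: "wasserstein_set d \<mu> hardy_weinberg = \<bar>2 * t - 2 * c - \<mu> $ 2\<bar>"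
      "wasserstein_argmin d \<mu> hardy_weinberg = hw_point ` {p. p = 1 - t \<or> c = a \<and> p = s}"
    if "c \<ge> a" "c \<ge> 1/4"
  proof -
    have st_eq: "s = t" if "c = a" using that by (simp add: st_def)
    \<comment> \<open>Reflected form of \<open>W_ge\<close>: with parameter \<open>1 - p\<close> the
      entries \<open>a\<close> and \<open>c\<close> exchange roles in the lower bound.\<close>
    have "\<bar>(1 - c - a) - 2 * (1 - p) * (1 - (1 - p))\<bar> \<le> W p" "\<bar>c - (1 - p)\<^sup>2\<bar> \<le> W p"
      "\<bar>a - (1 - (1 - p))\<^sup>2\<bar> \<le> W p" for p
      using W_ge[of p] by (auto simp: algebra_simps)
    note lb = hardy_weinberg_lower_bound[of t a "1 - p" "W p" for p, unfolded st,
        OF t[OF that(2)] st(4) that(1) _ _ this(2,1,3), folded u3_t]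
    have lower: "\<bar>2 * t - 2 * c - \<mu> $ 2\<bar> \<le> W p" if "p \<in> {0..1}" for p
      by (rule lb(1)) (use that in auto)
    have unique: "p \<in> {p. p = 1 - t \<or> c = a \<and> p = s}" if "p \<in> {0..1}" "\<bar>2 * t - 2 * c - \<mu> $ 2\<bar> = W p" for p
      using lb(2)[OF _ _ that(2)] that(1) st_eq by auto
    have attained: "W p = \<bar>2 * t - 2 * c - \<mu> $ 2\<bar>" if "p \<in> {p. p = 1 - t \<or> c = a \<and> p = s}" for p
      using that W_s W_t st_eq by auto
    have range: "{p. p = 1 - t \<or> c = a \<and> p = s} \<subseteq> {0..1}" "{p. p = 1 - t \<or> c = a \<and> p = s} \<noteq> {}"
      using t[OF that(2)] st(3,4) st_eq by auto
    show "wasserstein_set d \<mu> hardy_weinberg = \<bar>2 * t - 2 * c - \<mu> $ 2\<bar>"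
      "wasserstein_argmin d \<mu> hardy_weinberg = hw_point ` {p. p = 1 - t \<or> c = a \<and> p = s}"
      using minimum[OF lower unique range(2,1) attained] by blast+
  qed
  have case3: "wasserstein_set d \<mu> hardy_weinberg = \<mu> $ 2 - 1/2"
      "wasserstein_argmin d \<mu> hardy_weinberg = hw_point ` {1/2}"
    if "a \<le> 1/4" "c \<le> 1/4"
  proof -
    \<comment> \<open>Completing the square shows that the middle difference alone forces
      \<open>p = 1/2\<close> as the unique minimizer.\<close>
    have sq: "1 - a - c - 2 * p * (1 - p) = \<mu> $ 2 - 1/2 + 2 * (p - 1/2)\<^sup>2" for p
      by (simp add: b power2_eq_square algebra_simps)
    have W_half: "W (1/2) = \<mu> $ 2 - 1/2"
      using W_eq[of "1/2"] that unfolding b by (simp add: power2_eq_square)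
    have ge: "\<mu> $ 2 - 1/2 + 2 * (p - 1/2)\<^sup>2 \<le> W p" for p
      using W_ge(2)[of p] unfolding sq by linarith
    have lb: "\<mu> $ 2 - 1/2 \<le> W p" for p
      using ge[of p] zero_le_power2[of "p - 1/2"] by linarith
    have unique: "p \<in> {1/2}" if "\<mu> $ 2 - 1/2 = W p" for p
    proof -
      have "(p - 1/2)\<^sup>2 \<le> 0" using ge[of p] that by linarith
      then show ?thesis by simp
    qed
    have attained: "W p = \<mu> $ 2 - 1/2" if "p \<in> {1/2}" for p
      using that W_half by (simp only: singleton_iff)
    show "wasserstein_set d \<mu> hardy_weinberg = \<mu> $ 2 - 1/2"
      "wasserstein_argmin d \<mu> hardy_weinberg = hw_point ` {1/2}"
      using minimum[OF lb unique _ _ attained] by simp_all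
  qed
  \<comment> \<open>On the boundaries \<open>a = 1/4\<close> and \<open>c = 1/4\<close> the third
    case overlaps with the others, but gives the same point. Only the overlap \<open>a = c\<close>
    can yield two distinct minimizers.\<close>
  have s_half: "hw_point s = hw_point (1/2)" if "a = 1/4"
  proof -
    have "s = 1/2" unfolding st_def that by (simp add: real_sqrt_divide)
    then show ?thesis by (simp only:)
  qed
  have t_half: "hw_point (1 - t) = hw_point (1/2)" if "c = 1/4"
  proof -
    have "1 - t = 1/2" unfolding st_def that by (simp add: real_sqrt_divide)
    then show ?thesis by (simp only:)
  qed
  have argmin: "wasserstein_argmin d \<mu> hardy_weinberg =
      {\<nu>. (a \<ge> c \<and> a \<ge> 1/4 \<and> \<nu> = hw_point s) \<or> (a \<le> c \<and> c \<ge> 1/4 \<and> \<nu> = hw_point (1 - t)) \<or>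
           (a \<le> 1/4 \<and> c \<le> 1/4 \<and> \<nu> = hw_point (1/2))}"
  proof -
    consider "a \<ge> c" "a \<ge> 1/4" | "a < c" "c \<ge> 1/4" | "a < 1/4" "c < 1/4"
      by linarith
    then show ?thesis
    proof cases
      case 1
      have "hw_point ` {p. p = s \<or> c = a \<and> p = 1 - t} =
          {\<nu>. \<nu> = hw_point s \<or> (c = a \<and> \<nu> = hw_point (1 - t)) \<or> (a = 1/4 \<and> \<nu> = hw_point (1/2))}"
        using s_half by (intro set_eqI)
          (simp only: image_iff mem_Collect_eq bex_simps, metis)
      then show ?thesis
        unfolding case1(2)[OF 1] by (rule trans) (use 1 in \<open>intro Collect_cong, argo\<close>)
    next
      case 2
      have "hw_point ` {p. p = 1 - t \<or> c = a \<and> p = s} =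
          {\<nu>. \<nu> = hw_point (1 - t) \<or> (c = 1/4 \<and> \<nu> = hw_point (1/2))}"
        using t_half 2(1) by (intro set_eqI)
          (simp only: image_iff mem_Collect_eq bex_simps, metis less_irrefl)
      then show ?thesis
        unfolding case2(2)[OF less_imp_le[OF 2(1)] 2(2)]
        by (rule trans) (use 2 in \<open>intro Collect_cong, argo\<close>)
    next
      case 3
      then show ?thesis
        unfolding case3(2)[OF less_imp_le[OF 3(1)] less_imp_le[OF 3(2)]] by simp
    qed
  qed
  show ?thesis
    using case1(1) case2(1) case3(1) argmin
    unfolding pt_s pt_t pt_half
    unfolding st_def ac_def diff_ge_0_iff_ge diff_le_0_iff_le by blast
qed

end
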